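(* Let $G$ be a finite simple graph with maximum degree at least $2$, and let $\phi$ be a semi-transitive orientation of $G$. Then there exists a path $P=uvw$ of length $2$ in $G$ such that, writing $G'$ for the graph obtained from $G$ by lifting $P$, $\phi$ can be extended to a semi-transitive orientation of $G'$; that is, there is a semi-transitive orientation of $G'$ that agrees with $\phi$ on every edge of $E(G)\cap E(G')$.
   Context: Graphs are finite, undirected and simple. An orientation of a graph assigns to each edge one of its two directions; it is acyclic if it has no directed cycle. A digraph is transitive if whenever $v_1\to v_2$ and $v_2\to v_3$ are directed edges on three distinct vertices, $v_1\to v_3$ is also a directed edge. Given an acyclic orientation $\phi$ of a graph $G$, a shortcut in $\phi(G)$ is a non-transitive induced subdigraph of $\phi(G)$ on a vertex set $\{v_1,\dots,v_n\}$ with $n\ge 4$ (distinct vertices) that contains the directed path $v_1\to v_2\to\cdots\to v_n$ and the directed edge $v_1\to v_n$. An acyclic orientation $\phi$ is semi-transitive if $\phi(G)$ contains no shortcut. A path $uvw$ of length $2$ consists of three distinct vertices with $uv,vw\in E(G)$ (it need not be induced). The graph obtained from $G$ by lifting $uvw$ is the graph obtained from $G$ by removing the edges $uv$ and $vw$ and adding the edge $uw$ if $uw$ was not already an edge. *)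

theory Defs imports Main begin

text \<open>
  A graph is given by its vertex set and its set of edges, an edge being an unordered pair of
  distinct vertices, i.e. a two-element set. A digraph on these vertices is given by its arc
  relation.
\<close>

definition simple_graph :: "'a set \<Rightarrow> 'a set set \<Rightarrow> bool" where
  "simple_graph V E \<longleftrightarrow> finite V \<and> (\<forall>e\<in>E. e \<subseteq> V \<and> card e = 2)"

definition degree :: "'a set set \<Rightarrow> 'a \<Rightarrow> nat" where
  "degree E v = card {e \<in> E. v \<in> e}"

text \<open>The added \<open>0\<close> only matters for \<open>V = {}\<close>, where \<^const>\<open>Max\<close> would be unspecified.\<close>

definition max_degree :: "'a set \<Rightarrow> 'a set set \<Rightarrow> nat" where
  "max_degree V E = Max (insert 0 (degree E ` V))"

definition orientation :: "'a set set \<Rightarrow> ('a \<times> 'a) set \<Rightarrow> bool" where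
  "orientation E D \<longleftrightarrow>
     (\<forall>u v. (u, v) \<in> D \<longrightarrow> {u, v} \<in> E) \<and>
     (\<forall>u v. {u, v} \<in> E \<longrightarrow> ((u, v) \<in> D \<longleftrightarrow> (v, u) \<notin> D))"

text \<open>Unlike \<^const>\<open>trans\<close>, this only constrains triples of distinct vertices.\<close>

definition transitive_digraph :: "('a \<times> 'a) set \<Rightarrow> bool" where
  "transitive_digraph D \<longleftrightarrow>
     (\<forall>x y z. distinct [x, y, z] \<and> (x, y) \<in> D \<and> (y, z) \<in> D \<longrightarrow> (x, z) \<in> D)"

text \<open>\<^term>\<open>Restr D S\<close> is the arc relation of the subdigraph induced by \<^term>\<open>S\<close>.\<close>

definition induces_shortcut :: "('a \<times> 'a) set \<Rightarrow> 'a set \<Rightarrow> bool" where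
  "induces_shortcut D S \<longleftrightarrow>
     \<not> transitive_digraph (Restr D S) \<and>
     (\<exists>vs. S = set vs \<and> distinct vs \<and> length vs \<ge> 4 \<and>
           successively (\<lambda>x y. (x, y) \<in> D) vs \<and> (hd vs, last vs) \<in> D)"

definition semi_transitive_orientation :: "'a set set \<Rightarrow> ('a \<times> 'a) set \<Rightarrow> bool" where
  "semi_transitive_orientation E D \<longleftrightarrow>
     orientation E D \<and> acyclic D \<and> (\<nexists>S. induces_shortcut D S)"

definition path2 :: "'a set set \<Rightarrow> 'a \<Rightarrow> 'a \<Rightarrow> 'a \<Rightarrow> bool" where
  "path2 E u v w \<longleftrightarrow> distinct [u, v, w] \<and> {u, v} \<in> E \<and> {v, w} \<in> E"

text \<open>The edge set after lifting; the vertex set does not change.\<close>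

definition lift_path :: "'a set set \<Rightarrow> 'a \<Rightarrow> 'a \<Rightarrow> 'a \<Rightarrow> 'a set set" where
  "lift_path E u v w = insert {u, w} (E - {{u, v}, {v, w}})"

end

theory Submission imports Defs begin

text \<open>
  If the orientation contains a triangle \<open>u \<rightarrow> v \<rightarrow> w\<close>, \<open>u \<rightarrow> w\<close>, take one with \<open>w\<close> as early and then
  \<open>u\<close> as late as possible. Lifting only deletes arcs, so a new shortcut lives on a set that was
  transitive before; its failing triple is \<open>u \<rightarrow> y \<rightarrow> v\<close> or \<open>v \<rightarrow> y \<rightarrow> w\<close>, which gives a triangle
  contradicting the choice.

  Without triangles, semi-transitivity says that an arc is the only directed path between its
  ends. Take a directed path \<open>u \<rightarrow> v \<rightarrow> w\<close> with \<open>w\<close> as early as possible and add \<open>u \<rightarrow> w\<close>. A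
  shortcut closed by an old arc expands to a path of the old digraph parallel to that arc, while
  one closed by \<open>u \<rightarrow> w\<close> starts with a directed path of length 2 ending before \<open>w\<close>.

  If there are no directed paths of length 2, every vertex is a source or a sink, and after lifting
  at a vertex of degree at least 2 there is still no directed path of length 3.
\<close>

text \<open>Both directions of \<open>uv\<close> and \<open>vw\<close> are deleted because
  \<open>u\<close>, \<open>v\<close>, \<open>w\<close> need not form a directed path: the same
  formula serves when \<open>v\<close> is a source or a sink. The direction from \<open>u\<close> to
  \<open>w\<close> is fixed, hence the recurring hypothesis \<open>(w, u) \<notin> D\<close>, which
  keeps \<open>uw\<close> from receiving both directions.\<close>

definition lift_arcs :: "('a \<times> 'a) set \<Rightarrow> 'a \<Rightarrow> 'a \<Rightarrow> 'a \<Rightarrow> ('a \<times> 'a) set" where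
  "lift_arcs D u v w = insert (u, w) (D - {(u, v), (v, u), (v, w), (w, v)})"

lemma lift_arcs_iff:
  assumes "{x, y} \<noteq> {u, v}" "{x, y} \<noteq> {v, w}" "{x, y} \<noteq> {u, w}"
  shows "(x, y) \<in> lift_arcs D u v w \<longleftrightarrow> (x, y) \<in> D"
  using assms unfolding lift_arcs_def by blast

lemma lift_arcs_new:
  assumes "distinct [u, v, w]" "(w, u) \<notin> D"
  shows "(u, w) \<in> lift_arcs D u v w" "(w, u) \<notin> lift_arcs D u v w"
  using assms by (simp_all add: lift_arcs_def)

lemma orientation_lift_arcs:
  assumes ori: "orientation E D" and arc: "distinct [u, v, w]" "(w, u) \<notin> D"
  shows "orientation (lift_path E u v w) (lift_arcs D u v w)"
  unfolding orientation_def
proof (intro conjI allI impI)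
  fix x y
  assume xy: "(x, y) \<in> lift_arcs D u v w"
  show "{x, y} \<in> lift_path E u v w"
  proof (cases "(x, y) = (u, w)")
    case False
    with xy have "(x, y) \<in> D" "{x, y} \<noteq> {u, v}" "{x, y} \<noteq> {v, w}"
      unfolding lift_arcs_def doubleton_eq_iff by blast+
    with ori show ?thesis unfolding orientation_def lift_path_def by blast
  qed (simp add: lift_path_def)
next
  fix x y
  assume xy: "{x, y} \<in> lift_path E u v w"
  show "(x, y) \<in> lift_arcs D u v w \<longleftrightarrow> (y, x) \<notin> lift_arcs D u v w"
  proof (cases "{x, y} = {u, w}")
    case True
    then have "x = u \<and> y = w \<or> x = w \<and> y = u" by (simp add: doubleton_eq_iff)
    then show ?thesis using lift_arcs_new[OF arc] by blast
  next
    case False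
    with xy have e: "{x, y} \<in> E" "{x, y} \<noteq> {u, v}" "{x, y} \<noteq> {v, w}"
      by (simp_all add: lift_path_def)
    then have "(x, y) \<in> D \<longleftrightarrow> (y, x) \<notin> D" using ori by (simp add: orientation_def)
    then show ?thesis
      using e(2,3) False by (simp add: lift_arcs_iff insert_commute[of y x "{}"])
  qed
qed

lemma lift_arcs_agrees:
  assumes ori: "orientation E D" and arc: "distinct [u, v, w]" "(w, u) \<notin> D"
    and xy: "{x, y} \<in> E \<inter> lift_path E u v w"
  shows "(x, y) \<in> lift_arcs D u v w \<longleftrightarrow> (x, y) \<in> D"
proof (cases "{x, y} = {u, w}")
  case True
  then have "{u, w} \<in> E" using xy by simp
  then have "(u, w) \<in> D" using ori arc(2) unfolding orientation_def by blast
  moreover have "x = u \<and> y = w \<or> x = w \<and> y = u" using True by (simp add: doubleton_eq_iff)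
  ultimately show ?thesis using lift_arcs_new[OF arc] arc(2) by blast
next
  case False
  then show ?thesis using xy by (intro lift_arcs_iff) (simp_all add: lift_path_def)
qed

text \<open>In an acyclic orientation every triangle of the graph is oriented this way, so there
  this is triangle-freeness of the underlying graph.\<close>

definition triangle_free :: "('a \<times> 'a) set \<Rightarrow> bool" where
  "triangle_free D \<longleftrightarrow> (\<forall>x y z. (x, y) \<in> D \<longrightarrow> (y, z) \<in> D \<longrightarrow> (x, z) \<notin> D)"

lemma trancl_imp_successively:
  assumes "(a, b) \<in> D\<^sup>+"
  obtains vs where "successively (\<lambda>x y. (x, y) \<in> D) vs" "hd vs = a" "last vs = b" "length vs \<ge> 2"
proof -
  from assms have "\<exists>vs. successively (\<lambda>x y. (x, y) \<in> D) vs \<and> hd vs = a \<and> last vs = b \<and> length vs \<ge> 2"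
  proof (induction rule: converse_trancl_induct)
    case (base y)
    then show ?case by (intro exI[of _ "[y, b]"]) auto
  next
    case (step y z)
    then obtain vs where "successively (\<lambda>x y. (x, y) \<in> D) vs" "hd vs = z" "last vs = b" "length vs \<ge> 2"
      by blast
    with step(1) show ?case
      by (intro exI[of _ "y # vs"]) (auto simp: successively_Cons)
  qed
  with that show ?thesis by blast
qed

lemma successively_imp_trancl:
  assumes "successively (\<lambda>x y. (x, y) \<in> D) (a # vs)" "x \<in> set vs"
  shows "(a, x) \<in> D\<^sup>+"
  using assms
proof (induction vs arbitrary: a)
  case (Cons b vs)
  then show ?case by (auto intro: trancl_into_trancl2)
qed simp

lemma acyclic_successively_distinct:
  assumes "acyclic D" "successively (\<lambda>x y. (x, y) \<in> D) vs"
  shows "distinct vs"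
  using assms(2)
proof (induction vs)
  case (Cons a vs)
  then have "distinct vs" by (cases vs) simp_all
  moreover have "a \<notin> set vs"
    using successively_imp_trancl[OF Cons.prems] assms(1) by (auto simp: acyclic_def)
  ultimately show ?case by simp
qed simp

text \<open>With at least 4 vertices, the path of a shortcut begins \<open>a\<close>,
  \<open>c\<close>, \<open>d\<close> and still has to go on to its end \<open>b\<close>. Both cases
  without triangles refute shortcuts from these arcs.\<close>

lemma shortcut_start:
  assumes "induces_shortcut D S"
  obtains a b c d where "(a, b) \<in> D" "(a, c) \<in> D" "(c, d) \<in> D" "(d, b) \<in> D\<^sup>+"
proof -
  obtain vs where vs: "length vs \<ge> 4" "successively (\<lambda>x y. (x, y) \<in> D) vs" "(hd vs, last vs) \<in> D"
    using assms unfolding induces_shortcut_def by blast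
  obtain a c d e ws where eq: "vs = a # c # d # e # ws"
    using vs(1) by (auto simp: numeral_eq_Suc Suc_le_length_iff)
  have "(d, last vs) \<in> D\<^sup>+"
    using successively_imp_trancl[of D d "e # ws" "last vs"] vs(2) by (auto simp: eq)
  with vs show ?thesis by (intro that[of a "last vs" c d]) (auto simp: eq)
qed

text \<open>A path of length 2 parallel to the arc closes a triangle. A longer one has at least 4
  vertices and, not being a shortcut, induces a transitive subdigraph, so its first two arcs already
  lie in a triangle.\<close>

lemma triangle_free_arc_unique_path:
  assumes "acyclic D" "\<nexists>S. induces_shortcut D S" "triangle_free D"
    and "(a, b) \<in> D" "(a, c) \<in> D\<^sup>+" "(c, b) \<in> D\<^sup>+"
  shows False
proof -
  \<comment> \<open>Passing from \<open>c\<close> to the successor \<open>c'\<close> of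
    \<open>a\<close> makes the first step an explicit arc; a vertex list is then needed only from
    \<open>c'\<close> to \<open>b\<close>.\<close>
  obtain c' where c': "(a, c') \<in> D" "(c', c) \<in> D\<^sup>*"
    using assms(5) by (meson tranclD)
  then have "(c', b) \<in> D\<^sup>+" using assms(6) by simp
  then obtain vs where vs: "successively (\<lambda>x y. (x, y) \<in> D) vs" "hd vs = c'" "last vs = b" "length vs \<ge> 2"
    by (rule trancl_imp_successively)
  then obtain d ws where eq: "vs = c' # d # ws"
    by (auto simp: numeral_eq_Suc Suc_le_length_iff)
  have cd: "(c', d) \<in> D" using vs(1) by (simp add: eq)
  show False
  proof (cases "ws = []")
    case True
    then show False using cd c' assms(3,4) vs(3) by (auto simp: eq triangle_free_def)
  next
    case False
    have path: "successively (\<lambda>x y. (x, y) \<in> D) (a # vs)"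
      using vs(1) c'(1) by (simp add: eq)
    have dist: "distinct (a # vs)"
      by (rule acyclic_successively_distinct[OF assms(1) path])
    have "length (a # vs) \<ge> 4" using False by (cases ws) (auto simp: eq)
    moreover have "(hd (a # vs), last (a # vs)) \<in> D" using assms(4) vs(3) by (simp add: eq)
    ultimately have "transitive_digraph (Restr D (set (a # vs)))"
      using assms(2) path dist unfolding induces_shortcut_def by blast
    moreover have "distinct [a, c', d]" using dist by (simp add: eq)
    moreover have "(a, c') \<in> Restr D (set (a # vs))" "(c', d) \<in> Restr D (set (a # vs))"
      using cd c'(1) by (simp_all add: eq)
    ultimately have "(a, d) \<in> D"
      unfolding transitive_digraph_def by blast
    then show False using cd c' assms(3) by (auto simp: triangle_free_def)
  qed
qed

text \<open>\<open>w_min\<close> and \<open>u_max\<close> are what the extremal choice yields: a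
  triangle with sink \<open>v\<close> would end earlier than \<open>w\<close>, and one with source
  \<open>v\<close> and sink \<open>w\<close> would start later than \<open>u\<close>.\<close>

lemma lift_triangle:
  assumes ori: "orientation E D" and acyc: "acyclic D" and sf: "\<nexists>S. induces_shortcut D S"
    and uvw: "(u, v) \<in> D" "(v, w) \<in> D" "(u, w) \<in> D"
    and w_min: "\<And>x y. (x, y) \<in> D \<Longrightarrow> (y, v) \<in> D \<Longrightarrow> (x, v) \<notin> D"
    and u_max: "\<And>y. (v, y) \<in> D \<Longrightarrow> (y, w) \<notin> D"
    and arc: "distinct [u, v, w]" "(w, u) \<notin> D"
  shows "semi_transitive_orientation (lift_path E u v w) (lift_arcs D u v w)"
proof -
  let ?D = "lift_arcs D u v w"
  have sub: "?D \<subseteq> D" using uvw by (auto simp: lift_arcs_def)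
  have removed: "(x, y) = (u, v) \<or> (x, y) = (v, w)" if "(x, y) \<in> D" "(x, y) \<notin> ?D" for x y
  proof -
    have "(v, u) \<notin> D" "(w, v) \<notin> D"
      using acyc uvw by (meson acyclic_def r_into_trancl' trancl_into_trancl)+
    with that show ?thesis by (auto simp: lift_arcs_def)
  qed
  have "\<not> induces_shortcut ?D S" for S
  proof
    assume S: "induces_shortcut ?D S"
    then obtain vs where vs: "S = set vs" "distinct vs" "length vs \<ge> 4"
      "successively (\<lambda>x y. (x, y) \<in> ?D) vs" "(hd vs, last vs) \<in> ?D"
      and nt: "\<not> transitive_digraph (Restr ?D S)"
      unfolding induces_shortcut_def by blast
    have "successively (\<lambda>x y. (x, y) \<in> D) vs"
      using vs(4) by (rule successively_mono) (use sub in auto)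
    then have tr: "transitive_digraph (Restr D S)"
      using sf vs sub unfolding induces_shortcut_def by blast
    obtain x y z where xyz: "distinct [x, y, z]" "(x, y) \<in> Restr ?D S" "(y, z) \<in> Restr ?D S"
      "(x, z) \<notin> Restr ?D S"
      using nt unfolding transitive_digraph_def by blast
    have old: "(x, y) \<in> Restr D S" "(y, z) \<in> Restr D S"
      using xyz sub by auto
    then have "(x, z) \<in> Restr D S"
      using tr xyz(1) unfolding transitive_digraph_def by blast
    with xyz(4) have "(x, z) = (u, v) \<or> (x, z) = (v, w)"
      by (intro removed) auto
    then show False using old w_min u_max uvw by auto
  qed
  moreover have "acyclic ?D" using acyc sub by (rule acyclic_subset)
  ultimately show ?thesis
    using orientation_lift_arcs[OF ori arc] by (simp add: semi_transitive_orientation_def)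
qed

lemma lift_directed_path:
  assumes ori: "orientation E D" and acyc: "acyclic D" and sf: "\<nexists>S. induces_shortcut D S"
    and tf: "triangle_free D"
    and uvw: "(u, v) \<in> D" "(v, w) \<in> D"
    and w_min: "\<And>x y z. (x, y) \<in> D \<Longrightarrow> (y, z) \<in> D \<Longrightarrow> (z, w) \<notin> D\<^sup>+"
    and arc: "distinct [u, v, w]" "(w, u) \<notin> D"
  shows "semi_transitive_orientation (lift_path E u v w) (lift_arcs D u v w)"
proof -
  let ?D = "lift_arcs D u v w"
  have "(u, w) \<in> D\<^sup>+" using uvw by auto
  \<comment> \<open>The new arc can be replaced by the detour through \<open>v\<close>, so lifting
    creates no new reachability.\<close>
  then have sub: "?D \<subseteq> D\<^sup>+" by (auto simp: lift_arcs_def)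
  then have sub': "?D\<^sup>+ \<subseteq> D\<^sup>+" using trancl_mono_subset[OF sub] by simp
  have acyc': "acyclic ?D" using acyc sub' by (auto simp: acyclic_def)
  have "\<not> induces_shortcut ?D S" for S
  proof
    assume "induces_shortcut ?D S"
    then obtain a b c d where s: "(a, b) \<in> ?D" "(a, c) \<in> ?D" "(c, d) \<in> ?D" "(d, b) \<in> ?D\<^sup>+"
      by (rule shortcut_start)
    then have p: "(a, c) \<in> D\<^sup>+" "(c, d) \<in> D\<^sup>+" "(d, b) \<in> D\<^sup>+" using sub sub' by auto
    then have cb: "(c, b) \<in> D\<^sup>+" by auto
    show False
    proof (cases "(a, b) \<in> D")
      case True
      then show False using triangle_free_arc_unique_path[OF acyc sf tf _ p(1) cb] by simp
    next
      case False
      then have ab: "a = u" "b = w" using s(1) by (auto simp: lift_arcs_def)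
      \<comment> \<open>This shows that neither \<open>(u, c)\<close> nor \<open>(c, d)\<close> is
        the new arc; both are old and form a path whose end \<open>d\<close> precedes
        \<open>w\<close>.\<close>
      have "c \<noteq> w" "c \<noteq> u" using cb p(1) acyc by (auto simp: ab acyclic_def)
      then have "(u, c) \<in> D" "(c, d) \<in> D" using s(2,3) by (auto simp: ab lift_arcs_def)
      then show False using w_min p(3) ab by blast
    qed
  qed
  with acyc' show ?thesis
    using orientation_lift_arcs[OF ori arc] by (simp add: semi_transitive_orientation_def)
qed

lemma lift_source_or_sink:
  assumes ori: "orientation E D" and acyc: "acyclic D"
    and bip: "\<And>x y z. (x, y) \<in> D \<Longrightarrow> (y, z) \<notin> D"
    and uw: "\<And>x y. (x, u) \<in> D \<Longrightarrow> (w, y) \<notin> D"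
    and arc: "distinct [u, v, w]" "(w, u) \<notin> D"
  shows "semi_transitive_orientation (lift_path E u v w) (lift_arcs D u v w)"
proof -
  let ?D = "lift_arcs D u v w"
  have sub: "?D \<subseteq> insert (u, w) D" by (auto simp: lift_arcs_def)
  \<comment> \<open>Transitivity is vacuous since no two arcs compose; reachability in
    \<open>D\<close> is then a single arc or equality.\<close>
  have "trans D" using bip unfolding trans_def by blast
  then have "(w, u) \<notin> D\<^sup>*" using arc by (auto simp: rtrancl_eq_or_trancl)
  then have "acyclic (insert (u, w) D)" using acyc by simp
  then have "acyclic ?D" using sub by (rule acyclic_subset)
  moreover have "\<not> induces_shortcut ?D S" for S
  proof
    assume "induces_shortcut ?D S"
    then obtain a b c d where s: "(a, c) \<in> ?D" "(c, d) \<in> ?D" "(d, b) \<in> ?D\<^sup>+"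
      by (rule shortcut_start)
    then obtain e where "(d, e) \<in> ?D" by (meson tranclD)
    with s have "(a, c) \<in> insert (u, w) D" "(c, d) \<in> insert (u, w) D" "(d, e) \<in> insert (u, w) D"
      using sub by blast+
    moreover have "u \<noteq> w" using arc by simp
    \<comment> \<open>Neither two old arcs nor two copies of the new arc are consecutive. So the new
      arc is either in the middle, against \<open>uw\<close>, or first and third with the old arc
      \<open>(w, u)\<close> between, against \<open>arc(2)\<close>.\<close>
    ultimately show False using bip uw arc(2) by blast
  qed
  ultimately show ?thesis
    using orientation_lift_arcs[OF ori arc] by (simp add: semi_transitive_orientation_def)
qed

lemma wf_minimal_witness:
  assumes "wf r" "\<exists>x. P x"
  obtains z where "P z" "\<And>y. (y, z) \<in> r \<Longrightarrow> \<not> P y"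
proof -
  obtain x where "x \<in> {x. P x}" using assms(2) by blast
  then show ?thesis
    by (rule wfE_min[OF assms(1)]) (rule that; simp)
qed

lemma max_degree_ge_2_path2:
  assumes "simple_graph V E" "max_degree V E \<ge> 2"
  obtains u v w where "path2 E u v w"
proof -
  have fin: "finite (insert 0 (degree E ` V))" using assms(1) by (simp add: simple_graph_def)
  have "max_degree V E \<in> insert 0 (degree E ` V)"
    unfolding max_degree_def by (rule Max_in[OF fin]) simp
  then obtain v where "degree E v \<ge> 2" using assms(2) by auto
  \<comment> \<open>Infinite sets have \<open>card\<close> 0, so the degree bound also yields the
    finiteness required below.\<close>
  then have "\<not> card {e \<in> E. v \<in> e} \<le> Suc 0" "finite {e \<in> E. v \<in> e}"
    unfolding degree_def by (simp, metis card.infinite le_zero_eq zero_neq_numeral)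
  then obtain e f where ef: "e \<in> E" "f \<in> E" "v \<in> e" "v \<in> f" "e \<noteq> f"
    using card_le_Suc0_iff_eq by blast
  have other: "\<exists>u. g = {v, u} \<and> u \<noteq> v" if g: "g \<in> E" "v \<in> g" for g
  proof -
    have "card g = 2" using assms(1) g(1) by (simp add: simple_graph_def)
    then obtain x y where "g = {x, y}" "x \<noteq> y" by (meson card_2_iff)
    with g(2) show ?thesis by blast
  qed
  obtain u w where eq: "e = {v, u}" "f = {v, w}" "u \<noteq> v" "w \<noteq> v"
    using other[OF ef(1,3)] other[OF ef(2,4)] by blast
  then have "path2 E u v w"
    using ef by (auto simp: path2_def insert_commute[of u v])
  then show ?thesis by (rule that)
qed

theorem theorem1p9:
  fixes V :: "'a set" and E :: "'a set set" and D :: "('a \<times> 'a) set"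
  assumes "simple_graph V E"
    and "max_degree V E \<ge> 2"
    and "semi_transitive_orientation E D"
  shows "\<exists>u v w. path2 E u v w \<and>
           (\<exists>D'. semi_transitive_orientation (lift_path E u v w) D' \<and>
                 (\<forall>x y. {x, y} \<in> E \<inter> lift_path E u v w \<longrightarrow> ((x, y) \<in> D' \<longleftrightarrow> (x, y) \<in> D)))"
proof -
  have ori: "orientation E D" and acyc: "acyclic D" and sf: "\<nexists>S. induces_shortcut D S"
    using assms(3) by (auto simp: semi_transitive_orientation_def)
  have edge: "{x, y} \<in> E" if "(x, y) \<in> D" for x y
    using ori that by (auto simp: orientation_def)
  have "finite D"
  proof (rule finite_subset)
    have "{x, y} \<subseteq> V" if "(x, y) \<in> D" for x y
      using edge[OF that] assms(1) unfolding simple_graph_def by blast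
    then show "D \<subseteq> V \<times> V" by auto
    show "finite (V \<times> V)" using assms(1) by (simp add: simple_graph_def)
  qed
  then have wf: "wf (D\<^sup>+)" "wf (D\<inverse>)"
    using acyc by (blast intro: wf_trancl finite_acyclic_wf finite_acyclic_wf_converse)+
  have irr: "(x, x) \<notin> D\<^sup>+" for x using acyc by (simp add: acyclic_def)
  have path: "distinct [x, y, z] \<and> (z, x) \<notin> D" if "(x, y) \<in> D" "(y, z) \<in> D" for x y z
  proof -
    have "(x, z) \<in> D\<^sup>+" using that by auto
    then have "x \<noteq> z" "(z, x) \<notin> D" using irr by (metis, metis trancl_into_trancl)
    moreover have "x \<noteq> y" "y \<noteq> z" using that irr by (metis r_into_trancl')+
    ultimately show ?thesis by simp
  qed
  have goal: ?thesis if "path2 E u v w" "(w, u) \<notin> D"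
    "semi_transitive_orientation (lift_path E u v w) (lift_arcs D u v w)" for u v w
  proof -
    have "distinct [u, v, w]" using that(1) by (simp add: path2_def)
    note agree = lift_arcs_agrees[OF ori this that(2)]
    show ?thesis
      by (intro exI[of _ u] exI[of _ v] exI[of _ w] conjI exI[of _ "lift_arcs D u v w"] allI impI
          that(1,3) agree)
  qed
  consider (tri) "\<not> triangle_free D" | (dir) x y z where "triangle_free D" "(x, y) \<in> D" "(y, z) \<in> D"
    | (bip) "\<And>x y z. (x, y) \<in> D \<Longrightarrow> (y, z) \<notin> D" by blast
  then show ?thesis
  proof cases
    case tri
    \<comment> \<open>\<open>w\<close> is minimized over all triangles first; only then is
      \<open>u\<close> taken latest among the triangles with that sink.\<close>
    define T where "T u w \<longleftrightarrow> (u, w) \<in> D \<and> (\<exists>v. (u, v) \<in> D \<and> (v, w) \<in> D)" for u w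
    have "\<exists>w u. T u w" using tri by (auto simp: triangle_free_def T_def)
    with wf(1) obtain w where w: "\<exists>u. T u w" "\<And>z. (z, w) \<in> D\<^sup>+ \<Longrightarrow> \<not> (\<exists>u. T u z)"
      by (rule wf_minimal_witness) (rule that)
    from wf(2) w(1) obtain u where u: "T u w" "\<And>z. (z, u) \<in> D\<inverse> \<Longrightarrow> \<not> T z w"
      by (rule wf_minimal_witness) (rule that)
    from u(1) obtain v where uvw: "(u, v) \<in> D" "(v, w) \<in> D" "(u, w) \<in> D"
      unfolding T_def by blast
    have p: "path2 E u v w" "(w, u) \<notin> D"
      using path[OF uvw(1,2)] edge[OF uvw(1)] edge[OF uvw(2)] by (simp_all add: path2_def)
    have "semi_transitive_orientation (lift_path E u v w) (lift_arcs D u v w)"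
    proof (rule lift_triangle[OF ori acyc sf uvw])
      show "(x, v) \<notin> D" if "(x, y) \<in> D" "(y, v) \<in> D" for x y
        using w(2)[OF r_into_trancl, OF uvw(2)] that unfolding T_def by blast
      show "(y, w) \<notin> D" if "(v, y) \<in> D" for y
        using u(2)[of v] uvw that unfolding T_def by blast
    qed (use path[OF uvw(1,2)] in auto)
    with p show ?thesis by (intro goal) auto
  next
    case dir
    let ?P = "\<lambda>w. \<exists>u v. (u, v) \<in> D \<and> (v, w) \<in> D"
    have "\<exists>w. ?P w" using dir by blast
    with wf(1) obtain w where w: "?P w" "\<And>z. (z, w) \<in> D\<^sup>+ \<Longrightarrow> \<not> ?P z"
      by (rule wf_minimal_witness) (rule that)
    from w(1) obtain u v where uvw: "(u, v) \<in> D" "(v, w) \<in> D" by blast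
    have p: "path2 E u v w" "(w, u) \<notin> D"
      using path[OF uvw] edge[OF uvw(1)] edge[OF uvw(2)] by (simp_all add: path2_def)
    have "semi_transitive_orientation (lift_path E u v w) (lift_arcs D u v w)"
    proof (rule lift_directed_path[OF ori acyc sf dir(1) uvw])
      show "(z, w) \<notin> D\<^sup>+" if "(x, y) \<in> D" "(y, z) \<in> D" for x y z
        using w(2) that by blast
    qed (use path[OF uvw] in auto)
    with p show ?thesis by (intro goal) auto
  next
    case bip
    obtain u v w where p: "path2 E u v w"
      using max_degree_ge_2_path2[OF assms(1,2)] .
    then have "(u, v) \<in> D \<or> (v, u) \<in> D" "(v, w) \<in> D \<or> (w, v) \<in> D"
      using ori unfolding path2_def orientation_def by blast+
    then have "(u, v) \<in> D \<and> (w, v) \<in> D \<or> (v, u) \<in> D \<and> (v, w) \<in> D"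
      using bip by blast
    \<comment> \<open>If \<open>v\<close> is a sink, \<open>u\<close> is a source and nothing enters
      it; if \<open>v\<close> is a source, \<open>w\<close> is a sink and nothing leaves it.\<close>
    then have uw: "(w, u) \<notin> D" "\<And>x y. (x, u) \<in> D \<Longrightarrow> (w, y) \<notin> D"
      using bip by blast+
    have "semi_transitive_orientation (lift_path E u v w) (lift_arcs D u v w)"
    proof (rule lift_source_or_sink[OF ori acyc])
      show "(y, z) \<notin> D" if "(x, y) \<in> D" for x y z using that by (rule bip)
      show "(w, y) \<notin> D" if "(x, u) \<in> D" for x y using that by (rule uw(2))
    qed (use p uw(1) in \<open>auto simp: path2_def\<close>)
    with p uw(1) show ?thesis by (rule goal)
  qed
qed

end
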